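(* Let $X\subset\mathbb{R}$ be a measure space with measure $\mu$, $0<\mu(X)<\infty$, let $b,c\in[1,\infty)$ and let $f,g:X\to[0,\infty)$ be in $L^1(X,\mu)$ such that $f$ is $b$-almost monotone and $g$ is $c$-almost monotone. If $(f,g)$ is positively $(b,c)$-monotone, then $$\int_Xfg\,d\mu\ge\frac{b^{-1}+c^{-1}}{1+bc}\,\frac1{\mu(X)}\Big(\int_Xf\,d\mu\Big)\Big(\int_Xg\,d\mu\Big).$$ If $(f,g)$ is negatively $(b,c)$-monotone, then $$\int_Xfg\,d\mu\le\frac{b+c}{1+b^{-1}c^{-1}}\,\frac1{\mu(X)}\Big(\int_Xf\,d\mu\Big)\Big(\int_Xg\,d\mu\Big).$$
   Context: For $X\subset\mathbb{R}$ and $f:X\to[0,\infty)$: $f$ is $b$-almost increasing if $x\le y$ implies $f(x)\le bf(y)$ for all $x,y\in X$; $f$ is $b$-almost decreasing if $x\le y$ implies $f(y)\le bf(x)$; $b$-almost monotone means one of the two. $(f,g)$ is positively $(b,c)$-monotone if $f$ is $b$-almost increasing and $g$ is $c$-almost increasing, or $f$ is $b$-almost decreasing and $g$ is $c$-almost decreasing. $(f,g)$ is negatively $(b,c)$-monotone if $f$ is $b$-almost increasing and $g$ is $c$-almost decreasing, or vice versa. *)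

theory Defs
  imports "HOL-Analysis.Analysis"
begin

definition almost_increasing_on :: "real set \<Rightarrow> real \<Rightarrow> (real \<Rightarrow> real) \<Rightarrow> bool" where
  "almost_increasing_on X b f \<longleftrightarrow> (\<forall>x\<in>X. \<forall>y\<in>X. x \<le> y \<longrightarrow> f x \<le> b * f y)"

definition almost_decreasing_on :: "real set \<Rightarrow> real \<Rightarrow> (real \<Rightarrow> real) \<Rightarrow> bool" where
  "almost_decreasing_on X b f \<longleftrightarrow> (\<forall>x\<in>X. \<forall>y\<in>X. x \<le> y \<longrightarrow> f y \<le> b * f x)"

definition almost_monotone_on :: "real set \<Rightarrow> real \<Rightarrow> (real \<Rightarrow> real) \<Rightarrow> bool" where
  "almost_monotone_on X b f \<longleftrightarrow> almost_increasing_on X b f \<or> almost_decreasing_on X b f"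

definition positively_monotone_on ::
  "real set \<Rightarrow> real \<Rightarrow> real \<Rightarrow> (real \<Rightarrow> real) \<Rightarrow> (real \<Rightarrow> real) \<Rightarrow> bool" where
  "positively_monotone_on X b c f g \<longleftrightarrow>
     (almost_increasing_on X b f \<and> almost_increasing_on X c g) \<or>
     (almost_decreasing_on X b f \<and> almost_decreasing_on X c g)"

definition negatively_monotone_on ::
  "real set \<Rightarrow> real \<Rightarrow> real \<Rightarrow> (real \<Rightarrow> real) \<Rightarrow> (real \<Rightarrow> real) \<Rightarrow> bool" where
  "negatively_monotone_on X b c f g \<longleftrightarrow>
     (almost_increasing_on X b f \<and> almost_decreasing_on X c g) \<or>
     (almost_decreasing_on X b f \<and> almost_increasing_on X c g)"

end

theory Submission
  imports Defs
begin

text \<open>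
  The argument is a two-point version of Chebyshev's integral inequality. For points \<open>x\<close> and \<open>y\<close>
  compare the diagonal sum \<open>f x * g x + f y * g y\<close> with the crossed sum \<open>f x * g y + f y * g x\<close>.
  Integrated over both points, the first becomes \<open>2 \<mu>(X) \<integral>fg\<close> and the second \<open>2 (\<integral>f)(\<integral>g)\<close>, so that
  a pointwise bound of one sum by a multiple of the other is all that is needed.

  If \<open>x\<close> and \<open>y\<close> are ordered suitably, positive monotonicity says that \<open>b * f y - f x\<close> and
  \<open>c * g y - g x\<close> are nonnegative. Expanding their product gives an inequality between the
  four products of values with unequal weights; since \<open>b, c \<ge> 1\<close>, it can be weakened to one
  between the two sums (\<open>crossed_le_diagonal\<close>). The two sums do not change when the two points are
  exchanged, so the bound holds for all pairs, whatever their order. In the negative case the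
  two values of \<open>g\<close> change places in the product, which interchanges diagonal and crossed
  terms; a similar weakening then bounds the diagonal sum (\<open>diagonal_le_crossed\<close>).

  As \<open>fg\<close> may have infinite integral, the integration is carried out in the extended nonnegative
  reals, with iterated integrals of separated integrands.
\<close>

section \<open>Inequalities for two points\<close>

text \<open>
  Multiplying the expanded product \<open>(b * q - p) * (c * s - r) \<ge> 0\<close> by \<open>1 + b * c\<close> makes both
  crossed coefficients, \<open>b * (1 + b * c)\<close> and \<open>c * (1 + b * c)\<close>, at least \<open>b + c\<close>, while the
  diagonal ones are at most \<open>b * c * (1 + b * c)\<close>.
\<close>

lemma crossed_le_diagonal:
  fixes b c p q r s :: real
  assumes "1 \<le> b" "1 \<le> c" and nonneg: "0 \<le> p" "0 \<le> q" "0 \<le> r" "0 \<le> s"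
    and "p \<le> b * q" "r \<le> c * s"
  shows "(inverse b + inverse c) / (1 + b * c) * (p * s + q * r) \<le> p * r + q * s"
proof -
  have bc: "1 \<le> b * c"
    using mult_mono[of 1 b 1 c] assms by simp
  have b: "b + c \<le> (1 + b * c) * b"
    using mult_right_mono[of 1 "b * b" c] mult_mono[of 1 b 1 b] assms by (simp add: algebra_simps)
  have c: "b + c \<le> (1 + b * c) * c"
    using mult_right_mono[of 1 "c * c" b] mult_mono[of 1 c 1 c] assms by (simp add: algebra_simps)
  have "0 \<le> (b * q - p) * (c * s - r)"
    using assms by simp
  then have prod: "b * (q * r) + c * (p * s) \<le> b * c * (q * s) + p * r"
    by (simp add: algebra_simps)
  have "(b + c) * (p * s + q * r) = (b + c) * (q * r) + (b + c) * (p * s)"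
    by (simp add: algebra_simps)
  also have "\<dots> \<le> (1 + b * c) * b * (q * r) + (1 + b * c) * c * (p * s)"
    using b c nonneg by (intro add_mono mult_right_mono) auto
  also have "\<dots> = (1 + b * c) * (b * (q * r) + c * (p * s))"
    by (simp add: algebra_simps)
  also have "\<dots> \<le> (1 + b * c) * (b * c * (q * s) + p * r)"
    using prod bc by (intro mult_left_mono) auto
  also have "\<dots> \<le> (1 + b * c) * (b * c * (q * s) + b * c * (p * r))"
    using mult_right_mono[OF bc, of "p * r"] nonneg bc by (intro mult_left_mono add_mono) auto
  finally have main: "(b + c) * (p * s + q * r) \<le> (p * r + q * s) * (b * c * (1 + b * c))"
    by (simp add: algebra_simps)
  have "(inverse b + inverse c) / (1 + b * c) = (b + c) / (b * c * (1 + b * c))"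
    using assms by (simp add: field_simps)
  then show ?thesis
    using main bc by (simp add: pos_divide_le_eq)
qed

text \<open>
  Here the expanded product \<open>(b * q - p) * (c * r - s) \<ge> 0\<close> has weights \<open>b\<close> and \<open>c\<close> on the diagonal;
  multiplication by \<open>b + c\<close> makes them at least \<open>1 + b * c\<close>, while the crossed ones are at
  most \<open>b * c * (b + c)\<close>.
\<close>

lemma diagonal_le_crossed:
  fixes b c p q r s :: real
  assumes "1 \<le> b" "1 \<le> c" and nonneg: "0 \<le> p" "0 \<le> q" "0 \<le> r" "0 \<le> s"
    and "p \<le> b * q" "s \<le> c * r"
  shows "p * r + q * s \<le> (b + c) / (1 + inverse b * inverse c) * (p * s + q * r)"
proof -
  have bc: "1 \<le> b * c"
    using mult_mono[of 1 b 1 c] assms by simp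
  have b: "1 + b * c \<le> (b + c) * b"
    using mult_mono[of 1 b 1 b] assms by (simp add: algebra_simps)
  have c: "1 + b * c \<le> (b + c) * c"
    using mult_mono[of 1 c 1 c] assms by (simp add: algebra_simps)
  have "0 \<le> (b * q - p) * (c * r - s)"
    using assms by simp
  then have prod: "b * (q * s) + c * (p * r) \<le> b * c * (q * r) + p * s"
    by (simp add: algebra_simps)
  have "(1 + b * c) * (p * r + q * s) = (1 + b * c) * (q * s) + (1 + b * c) * (p * r)"
    by (simp add: algebra_simps)
  also have "\<dots> \<le> (b + c) * b * (q * s) + (b + c) * c * (p * r)"
    using b c nonneg by (intro add_mono mult_right_mono) auto
  also have "\<dots> = (b + c) * (b * (q * s) + c * (p * r))"
    by (simp add: algebra_simps)
  also have "\<dots> \<le> (b + c) * (b * c * (q * r) + p * s)"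
    using prod assms by (intro mult_left_mono) auto
  also have "\<dots> \<le> (b + c) * (b * c * (q * r) + b * c * (p * s))"
    using mult_right_mono[OF bc, of "p * s"] assms by (intro mult_left_mono add_mono) auto
  finally have main: "(p * r + q * s) * (1 + b * c) \<le> (b + c) * (b * c) * (p * s + q * r)"
    by (simp add: algebra_simps)
  have "(b + c) / (1 + inverse b * inverse c) = (b + c) * (b * c) / (1 + b * c)"
    using assms by (simp add: field_simps)
  then show ?thesis
    using main bc by (simp add: pos_le_divide_eq)
qed

text \<open>
  Any two points are comparable, and both sides are symmetric in them; so it is enough to
  have the hypotheses of the preceding inequalities for one of the two orders.
\<close>

lemma positively_monotone_on_crossed_le_diagonal:
  assumes "positively_monotone_on X b c f g" "1 \<le> b" "1 \<le> c"
    and "f \<in> X \<rightarrow> {0..}" "g \<in> X \<rightarrow> {0..}" and "x \<in> X" "y \<in> X"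
  shows "(inverse b + inverse c) / (1 + b * c) * (f x * g y + f y * g x) \<le> f x * g x + f y * g y"
proof -
  have nonneg: "0 \<le> f x" "0 \<le> f y" "0 \<le> g x" "0 \<le> g y"
    using assms(4-7) by (auto simp: Pi_iff)
  have "(f x \<le> b * f y \<and> g x \<le> c * g y) \<or> (f y \<le> b * f x \<and> g y \<le> c * g x)"
    using assms(1,6,7) linear[of x y]
    unfolding positively_monotone_on_def almost_increasing_on_def almost_decreasing_on_def by blast
  then show ?thesis
    using crossed_le_diagonal[OF assms(2,3), of "f x" "f y" "g x" "g y"]
      crossed_le_diagonal[OF assms(2,3), of "f y" "f x" "g y" "g x"] nonneg
    by (auto simp: add.commute)
qed

lemma negatively_monotone_on_diagonal_le_crossed:
  assumes "negatively_monotone_on X b c f g" "1 \<le> b" "1 \<le> c"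
    and "f \<in> X \<rightarrow> {0..}" "g \<in> X \<rightarrow> {0..}" and "x \<in> X" "y \<in> X"
  shows "f x * g x + f y * g y
    \<le> (b + c) / (1 + inverse b * inverse c) * (f x * g y + f y * g x)"
proof -
  have nonneg: "0 \<le> f x" "0 \<le> f y" "0 \<le> g x" "0 \<le> g y"
    using assms(4-7) by (auto simp: Pi_iff)
  have "(f x \<le> b * f y \<and> g y \<le> c * g x) \<or> (f y \<le> b * f x \<and> g x \<le> c * g y)"
    using assms(1,6,7) linear[of x y]
    unfolding negatively_monotone_on_def almost_increasing_on_def almost_decreasing_on_def by blast
  then show ?thesis
    using diagonal_le_crossed[OF assms(2,3), of "f x" "f y" "g x" "g y"]
      diagonal_le_crossed[OF assms(2,3), of "f y" "f x" "g y" "g x"] nonneg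
    by (auto simp: add.commute)
qed

section \<open>Integration over both points\<close>

lemma nn_integral_nn_integral_diagonal:
  assumes [measurable]: "h \<in> borel_measurable M"
  shows "(\<integral>\<^sup>+ x. \<integral>\<^sup>+ y. h x + h y \<partial>M \<partial>M) = 2 * emeasure M (space M) * (\<integral>\<^sup>+ x. h x \<partial>M)"
  by (simp add: nn_integral_add nn_integral_multc mult_2 distrib_left distrib_right mult.commute)

lemma nn_integral_nn_integral_crossed:
  assumes [measurable]: "u \<in> borel_measurable M" "v \<in> borel_measurable M"
  shows "(\<integral>\<^sup>+ x. \<integral>\<^sup>+ y. u x * v y + u y * v x \<partial>M \<partial>M)
    = 2 * ((\<integral>\<^sup>+ x. u x \<partial>M) * (\<integral>\<^sup>+ x. v x \<partial>M))"
  by (simp add: nn_integral_add nn_integral_cmult nn_integral_multc mult_2)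

text \<open>
  Both directions of the comparison integrate in the same way; the factor \<open>2\<close> is the same on
  both sides and cancels.
\<close>

lemma (in finite_measure) nn_integral_mult_ge_if_crossed_le_diagonal:
  fixes f g :: "'a \<Rightarrow> real"
  assumes f: "integrable M f" "\<And>x. x \<in> space M \<Longrightarrow> 0 \<le> f x"
    and g: "integrable M g" "\<And>x. x \<in> space M \<Longrightarrow> 0 \<le> g x"
    and "0 < measure M (space M)" and "0 \<le> k"
    and le: "\<And>x y. x \<in> space M \<Longrightarrow> y \<in> space M \<Longrightarrow>
      k * (f x * g y + f y * g x) \<le> f x * g x + f y * g y"
  shows "ennreal (k * (1 / measure M (space M)) * (\<integral>x. f x \<partial>M) * (\<integral>x. g x \<partial>M))
    \<le> (\<integral>\<^sup>+ x. ennreal (f x * g x) \<partial>M)"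
proof -
  define I where "I = (\<integral>\<^sup>+ x. ennreal (f x * g x) \<partial>M)"
  define m where "m = measure M (space M)"
  define F where "F = (\<integral>x. f x \<partial>M)"
  define G where "G = (\<integral>x. g x \<partial>M)"
  have [measurable]: "f \<in> borel_measurable M" "g \<in> borel_measurable M"
    using f g by auto
  have F: "(\<integral>\<^sup>+ x. ennreal (f x) \<partial>M) = ennreal F" "0 \<le> F"
    using f unfolding F_def by (auto intro!: nn_integral_eq_integral integral_nonneg_AE)
  have G: "(\<integral>\<^sup>+ x. ennreal (g x) \<partial>M) = ennreal G" "0 \<le> G"
    using g unfolding G_def by (auto intro!: nn_integral_eq_integral integral_nonneg_AE)
  have "ennreal k * (2 * (ennreal F * ennreal G))
      = ennreal k * (\<integral>\<^sup>+ x. \<integral>\<^sup>+ y. ennreal (f x) * ennreal (g y) + ennreal (f y) * ennreal (g x) \<partial>M \<partial>M)"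
    by (simp add: nn_integral_nn_integral_crossed F G)
  also have "\<dots> = (\<integral>\<^sup>+ x. \<integral>\<^sup>+ y. ennreal k * (ennreal (f x) * ennreal (g y) + ennreal (f y) * ennreal (g x)) \<partial>M \<partial>M)"
    by (simp add: nn_integral_cmult nn_integral_add nn_integral_multc)
  also have "\<dots> \<le> (\<integral>\<^sup>+ x. \<integral>\<^sup>+ y. ennreal (f x * g x) + ennreal (f y * g y) \<partial>M \<partial>M)"
    using le f(2) g(2) \<open>0 \<le> k\<close>
    by (intro nn_integral_mono)
      (simp flip: ennreal_mult ennreal_plus)
  also have "\<dots> = 2 * ennreal m * I"
    by (simp add: nn_integral_nn_integral_diagonal I_def m_def emeasure_eq_measure)
  finally have ineq: "ennreal k * (2 * (ennreal F * ennreal G)) \<le> 2 * ennreal m * I" .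
  show ?thesis
    unfolding I_def[symmetric] m_def[symmetric] F_def[symmetric] G_def[symmetric]
  proof (cases I)
    case (real i)
    have "ennreal (k * (2 * (F * G))) \<le> ennreal (2 * m * i)"
      using ineq real F(2) G(2) \<open>0 \<le> k\<close> by (simp add: ennreal_mult m_def)
    then have "k * F * G \<le> m * i"
      using real by (simp add: m_def ennreal_le_iff algebra_simps)
    then show "ennreal (k * (1 / m) * F * G) \<le> I"
      using real assms(5) by (simp add: m_def[symmetric] field_simps ennreal_leI)
  qed simp
qed

lemma (in finite_measure) nn_integral_mult_le_if_diagonal_le_crossed:
  fixes f g :: "'a \<Rightarrow> real"
  assumes f: "integrable M f" "\<And>x. x \<in> space M \<Longrightarrow> 0 \<le> f x"
    and g: "integrable M g" "\<And>x. x \<in> space M \<Longrightarrow> 0 \<le> g x"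
    and "0 < measure M (space M)" and "0 \<le> k"
    and le: "\<And>x y. x \<in> space M \<Longrightarrow> y \<in> space M \<Longrightarrow>
      f x * g x + f y * g y \<le> k * (f x * g y + f y * g x)"
  shows "(\<integral>\<^sup>+ x. ennreal (f x * g x) \<partial>M)
    \<le> ennreal (k * (1 / measure M (space M)) * (\<integral>x. f x \<partial>M) * (\<integral>x. g x \<partial>M))"
proof -
  define I where "I = (\<integral>\<^sup>+ x. ennreal (f x * g x) \<partial>M)"
  define m where "m = measure M (space M)"
  define F where "F = (\<integral>x. f x \<partial>M)"
  define G where "G = (\<integral>x. g x \<partial>M)"
  have [measurable]: "f \<in> borel_measurable M" "g \<in> borel_measurable M"
    using f g by auto
  have F: "(\<integral>\<^sup>+ x. ennreal (f x) \<partial>M) = ennreal F" "0 \<le> F"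
    using f unfolding F_def by (auto intro!: nn_integral_eq_integral integral_nonneg_AE)
  have G: "(\<integral>\<^sup>+ x. ennreal (g x) \<partial>M) = ennreal G" "0 \<le> G"
    using g unfolding G_def by (auto intro!: nn_integral_eq_integral integral_nonneg_AE)
  have "2 * ennreal m * I = (\<integral>\<^sup>+ x. \<integral>\<^sup>+ y. ennreal (f x * g x) + ennreal (f y * g y) \<partial>M \<partial>M)"
    by (simp add: nn_integral_nn_integral_diagonal I_def m_def emeasure_eq_measure)
  also have "\<dots> \<le> (\<integral>\<^sup>+ x. \<integral>\<^sup>+ y. ennreal k * (ennreal (f x) * ennreal (g y) + ennreal (f y) * ennreal (g x)) \<partial>M \<partial>M)"
    using le f(2) g(2) \<open>0 \<le> k\<close>
    by (intro nn_integral_mono)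
      (simp flip: ennreal_mult ennreal_plus)
  also have "\<dots> = ennreal k * (\<integral>\<^sup>+ x. \<integral>\<^sup>+ y. ennreal (f x) * ennreal (g y) + ennreal (f y) * ennreal (g x) \<partial>M \<partial>M)"
    by (simp add: nn_integral_cmult nn_integral_add nn_integral_multc)
  also have "\<dots> = ennreal k * (2 * (ennreal F * ennreal G))"
    by (simp add: nn_integral_nn_integral_crossed F G)
  finally have ineq: "2 * ennreal m * I \<le> ennreal k * (2 * (ennreal F * ennreal G))" .
  show ?thesis
    unfolding I_def[symmetric] m_def[symmetric] F_def[symmetric] G_def[symmetric]
  proof (cases I)
    case (real i)
    have "ennreal (2 * m * i) \<le> ennreal (k * (2 * (F * G)))"
      using ineq real F(2) G(2) \<open>0 \<le> k\<close> by (simp add: ennreal_mult m_def)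
    then have "m * i \<le> k * F * G"
      using F(2) G(2) \<open>0 \<le> k\<close> by (simp add: ennreal_le_iff algebra_simps)
    then show "I \<le> ennreal (k * (1 / m) * F * G)"
      using real assms(5) by (simp add: m_def[symmetric] field_simps ennreal_leI)
  next
    \<comment> \<open>An infinite integral of the product is excluded, since the crossed side is finite.\<close>
    case top
    then have "2 * ennreal m * I = top"
      using assms(5) by (simp add: m_def ennreal_mult_top)
    moreover have "ennreal k * (2 * (ennreal F * ennreal G)) < top"
      by (simp add: ennreal_mult_less_top)
    ultimately show "I \<le> ennreal (k * (1 / m) * F * G)"
      using ineq by (simp add: top_unique)
  qed
qed

section \<open>The integral inequalities\<close>

theorem theorem2p12:
  fixes X :: "real set" and M :: "real measure" and b c :: real and f g :: "real \<Rightarrow> real"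
  assumes "space M = X"
    and "0 < emeasure M X" and "emeasure M X < \<infinity>"
    and "1 \<le> b" and "1 \<le> c"
    and "f \<in> X \<rightarrow> {0..}" and "g \<in> X \<rightarrow> {0..}"
    and "integrable M f" and "integrable M g"
    and "almost_monotone_on X b f" and "almost_monotone_on X c g"
  shows "(positively_monotone_on X b c f g \<longrightarrow>
            (\<integral>\<^sup>+ x. ennreal (f x * g x) \<partial>M) \<ge>
            ennreal ((inverse b + inverse c) / (1 + b * c) * (1 / measure M X)
              * (\<integral>x. f x \<partial>M) * (\<integral>x. g x \<partial>M))) \<and>
         (negatively_monotone_on X b c f g \<longrightarrow>
            (\<integral>\<^sup>+ x. ennreal (f x * g x) \<partial>M) \<le>
            ennreal ((b + c) / (1 + inverse b * inverse c) * (1 / measure M X)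
              * (\<integral>x. f x \<partial>M) * (\<integral>x. g x \<partial>M)))"
proof -
  interpret finite_measure M
    using assms(1,3) by (intro finite_measureI) auto
  have m: "0 < measure M (space M)"
    using assms(1,2) by (simp add: emeasure_eq_measure)
  have nonneg: "\<And>x. x \<in> space M \<Longrightarrow> 0 \<le> f x" "\<And>x. x \<in> space M \<Longrightarrow> 0 \<le> g x"
    using assms(1,6,7) by auto
  show ?thesis
  proof (intro conjI impI)
    assume pos: "positively_monotone_on X b c f g"
    show "ennreal ((inverse b + inverse c) / (1 + b * c) * (1 / measure M X)
        * (\<integral>x. f x \<partial>M) * (\<integral>x. g x \<partial>M)) \<le> (\<integral>\<^sup>+ x. ennreal (f x * g x) \<partial>M)"
      unfolding assms(1)[symmetric]
      using positively_monotone_on_crossed_le_diagonal[OF pos assms(4-7)] assms(1,4,5)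
      by (intro nn_integral_mult_ge_if_crossed_le_diagonal assms(8,9) nonneg m) auto
  next
    assume neg: "negatively_monotone_on X b c f g"
    show "(\<integral>\<^sup>+ x. ennreal (f x * g x) \<partial>M)
        \<le> ennreal ((b + c) / (1 + inverse b * inverse c) * (1 / measure M X)
        * (\<integral>x. f x \<partial>M) * (\<integral>x. g x \<partial>M))"
      unfolding assms(1)[symmetric]
      using negatively_monotone_on_diagonal_le_crossed[OF neg assms(4-7)] assms(1,4,5)
      by (intro nn_integral_mult_le_if_diagonal_le_crossed assms(8,9) nonneg m) auto
  qed
qed

end
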